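(* Let $f=h+\overline{g}\in\mathcal{H}$ be a sense-preserving harmonic mapping in $\mathbb{D}$ with dilatation $q(z)=\omega^2(z)=g'(z)/h'(z)$, where $\omega:\mathbb{D}\to\mathbb{D}$ is an analytic function. Then either $\|\mathbb{P}_f\|=\|P_h\|=\infty$, or both $\|\mathbb{P}_f\|$ and $\|P_h\|$ are finite. If $\|\mathbb{P}_f\|<\infty$, then $$\Big|\,\|\mathbb{P}_f\|-\|P_h\|\,\Big|\le \frac{2r_0(1-r_0^2)}{1+r_0^2}\approx 0.6005\ldots,\qquad r_0=\sqrt{\sqrt{5}-2},$$ and the estimate is sharp, i.e. the constant on the right-hand side cannot be replaced by any smaller constant valid for all such $f$.
   Context: $\mathbb{D}=\{z\in\mathbb{C}:|z|<1\}$. $\mathcal{H}$ is the class of all complex-valued harmonic mappings $f=h+\overline{g}$ in $\mathbb{D}$ with $h,g$ analytic in $\mathbb{D}$ and $h(0)=h'(0)-1=g(0)=0$. The Jacobian is $J_f=|h'|^2-|g'|^2$, and $f$ is sense-preserving if $J_f(z)>0$ for all $z\in\mathbb{D}$ (so $h'\neq 0$ and the dilatation $g'/h'$ is analytic with modulus less than $1$). For the locally univalent analytic function $h$, the pre-Schwarzian derivative is $P_h=h''/h'$. For a sense-preserving $f=h+\overline{g}$ whose dilatation is $g'/h'=\omega^2$ with $\omega:\mathbb{D}\to\mathbb{D}$ analytic, the pre-Schwarzian derivative $\mathbb{P}_f$ is $$\mathbb{P}_f=2\,\frac{\partial}{\partial z}\log\lambda=\frac{h''}{h'}+\frac{2\overline{\omega}\,\omega'}{1+|\omega|^2},\qquad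 \lambda=|h'|+|g'|.$$ The norms are $\|P_h\|=\sup_{z\in\mathbb{D}}(1-|z|^2)|P_h(z)|$ and $\|\mathbb{P}_f\|=\sup_{z\in\mathbb{D}}(1-|z|^2)|\mathbb{P}_f(z)|$, with values in $[0,\infty]$. *)

theory Defs
  imports "HOL-Complex_Analysis.Complex_Analysis"
begin

abbreviation unit_disk :: "complex set" where
  "unit_disk \<equiv> ball 0 1"

text \<open>The normalisation determines \<open>h\<close> and \<open>g\<close> on the unit disk from \<open>f\<close>. Quantities attached to
  \<open>f\<close> are therefore defined as functions of the pair \<open>h\<close>, \<open>g\<close>.\<close>

definition harmonic_class :: "(complex \<Rightarrow> complex) \<Rightarrow> (complex \<Rightarrow> complex) \<Rightarrow> (complex \<Rightarrow> complex) \<Rightarrow> bool"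
  where "harmonic_class f h g \<longleftrightarrow>
    h holomorphic_on unit_disk \<and> g holomorphic_on unit_disk \<and>
    (\<forall>z\<in>unit_disk. f z = h z + cnj (g z)) \<and>
    h 0 = 0 \<and> deriv h 0 = 1 \<and> g 0 = 0"

definition jacobian :: "(complex \<Rightarrow> complex) \<Rightarrow> (complex \<Rightarrow> complex) \<Rightarrow> complex \<Rightarrow> real"
  where "jacobian h g z = (cmod (deriv h z))\<^sup>2 - (cmod (deriv g z))\<^sup>2"

definition sense_preserving :: "(complex \<Rightarrow> complex) \<Rightarrow> (complex \<Rightarrow> complex) \<Rightarrow> bool"
  where "sense_preserving h g \<longleftrightarrow> (\<forall>z\<in>unit_disk. jacobian h g z > 0)"

definition dilatation :: "(complex \<Rightarrow> complex) \<Rightarrow> (complex \<Rightarrow> complex) \<Rightarrow> complex \<Rightarrow> complex"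
  where "dilatation h g z = deriv g z / deriv h z"

text \<open>The Wirtinger derivative \<open>\<partial>F/\<partial>z = (F\<^sub>x - \<i> F\<^sub>y) / 2\<close>; the real partial derivatives are the
  values of the Frechet derivative at \<open>1\<close> and \<open>\<i>\<close>.\<close>

definition wirtinger_dz :: "(complex \<Rightarrow> complex) \<Rightarrow> complex \<Rightarrow> complex"
  where "wirtinger_dz F z =
    (frechet_derivative F (at z) 1 - \<i> * frechet_derivative F (at z) \<i>) / 2"

definition pre_schwarzian :: "(complex \<Rightarrow> complex) \<Rightarrow> complex \<Rightarrow> complex"
  where "pre_schwarzian h z = deriv (deriv h) z / deriv h z"

definition harmonic_pre_schwarzian ::
    "(complex \<Rightarrow> complex) \<Rightarrow> (complex \<Rightarrow> complex) \<Rightarrow> complex \<Rightarrow> complex"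
  where "harmonic_pre_schwarzian h g z =
    2 * wirtinger_dz (\<lambda>w. complex_of_real (ln (cmod (deriv h w) + cmod (deriv g w)))) z"

definition hyperbolic_norm :: "(complex \<Rightarrow> complex) \<Rightarrow> ennreal"
  where "hyperbolic_norm P = (SUP z\<in>unit_disk. ennreal ((1 - (cmod z)\<^sup>2) * cmod (P z)))"

definition r0 :: real
  where "r0 = sqrt (sqrt 5 - 2)"

lemma has_derivative_cmod_sq:
  fixes f :: "complex \<Rightarrow> complex"
  assumes "(f has_field_derivative f') (at z)"
  shows "((\<lambda>w. (cmod (f w))\<^sup>2) has_derivative (\<lambda>v. 2 * Re (cnj (f z) * f' * v))) (at z)"
proof -
  have d: "(f has_derivative (\<lambda>v. f' * v)) (at z)"
    using assms by (simp add: has_field_derivative_def)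
  have "((\<lambda>w. f w \<bullet> f w) has_derivative (\<lambda>v. f z \<bullet> (f' * v) + (f' * v) \<bullet> f z)) (at z)"
    by (rule has_derivative_inner[OF d d])
  moreover have "f z \<bullet> (f' * v) + (f' * v) \<bullet> f z = 2 * Re (cnj (f z) * f' * v)" for v
    by (simp add: inner_complex_def algebra_simps)
  ultimately show ?thesis
    by (simp add: power2_norm_eq_inner)
qed

text \<open>The closed form of the pre-Schwarzian derivative for a dilatation that is a square.\<close>

lemma harmonic_pre_schwarzian_eq:
  assumes hg: "harmonic_class f h g" and sp: "sense_preserving h g"
    and om: "\<omega> holomorphic_on unit_disk"
    and dil: "\<forall>z\<in>unit_disk. dilatation h g z = (\<omega> z)\<^sup>2"
    and z: "z \<in> unit_disk"
  shows "harmonic_pre_schwarzian h g z =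
    deriv (deriv h) z / deriv h z + 2 * cnj (\<omega> z) * deriv \<omega> z / (1 + (cmod (\<omega> z))\<^sup>2)"
    (is "_ = ?A")
proof -
  let ?h = "deriv h" and ?s = "\<lambda>w. (cmod (deriv h w))\<^sup>2" and ?t = "\<lambda>w. (cmod (\<omega> w))\<^sup>2"
  have nz: "?h w \<noteq> 0" if "w \<in> unit_disk" for w
    using sp that unfolding sense_preserving_def jacobian_def
    by (force simp: not_less[symmetric])
  have g': "deriv g w = ?h w * (\<omega> w)\<^sup>2" if "w \<in> unit_disk" for w
    using dil nz that by (auto simp: dilatation_def field_simps)
  have lam: "ln (cmod (?h w) + cmod (deriv g w)) = ln (?s w) / 2 + ln (1 + ?t w)"
    if w: "w \<in> unit_disk" for w
  proof -
    have "cmod (?h w) + cmod (deriv g w) = cmod (?h w) * (1 + ?t w)"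
      using g'[OF w] by (simp add: norm_mult norm_power algebra_simps)
    moreover have "1 + ?t w > 0"
      by (simp add: add_pos_nonneg)
    ultimately have "ln (cmod (?h w) + cmod (deriv g w)) = ln (cmod (?h w)) + ln (1 + ?t w)"
      using nz[OF w] by (simp add: ln_mult)
    moreover have "ln (?s w) = 2 * ln (cmod (?h w))"
      using nz[OF w] by (simp add: ln_realpow)
    ultimately show ?thesis by simp
  qed
  have "?h holomorphic_on unit_disk"
    using hg by (auto simp: harmonic_class_def intro: holomorphic_deriv)
  then have dh: "(?h has_field_derivative deriv ?h z) (at z)"
    using z by (auto intro: holomorphic_derivI)
  have dom: "(\<omega> has_field_derivative deriv \<omega> z) (at z)"
    using om z by (auto intro: holomorphic_derivI)
  have pos: "?s z > 0" "1 + ?t z > 0"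
    using nz[OF z] by (auto simp: add_pos_nonneg)
  have D1: "((\<lambda>w. ln (?s w)) has_derivative (\<lambda>v. 2 * Re (cnj (?h z) * deriv ?h z * v) * inverse (?s z))) (at z)"
    using has_derivative_ln[OF pos(1) has_derivative_cmod_sq[OF dh]]
    by (simp add: divide_inverse)
  have D2': "((\<lambda>w. 1 + ?t w) has_derivative (\<lambda>v. 2 * Re (cnj (\<omega> z) * deriv \<omega> z * v))) (at z)"
    using has_derivative_add[OF has_derivative_const has_derivative_cmod_sq[OF dom]] by simp
  have D2: "((\<lambda>w. ln (1 + ?t w)) has_derivative
      (\<lambda>v. 2 * Re (cnj (\<omega> z) * deriv \<omega> z * v) * inverse (1 + ?t z))) (at z)"
    using has_derivative_ln[OF pos(2) D2'] by (simp add: divide_inverse)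
  have "((\<lambda>w. ln (?s w) * (1/2) + ln (1 + ?t w)) has_derivative (\<lambda>v. Re (?A * v))) (at z)"
  proof (rule has_derivative_eq_rhs[OF has_derivative_add[OF has_derivative_mult_left[OF D1] D2]], rule ext)
    fix v
    have aux: "2 * R * i * (1/2) + 2 * S * j = i * R + 2 * j * S" for R S i j :: real
      by simp
    have a: "deriv ?h z / ?h z = cnj (?h z) * deriv ?h z * of_real (inverse (?s z))"
      using nz[OF z] complex_norm_square[of "?h z"] by (simp add: field_simps)
    have "?A = cnj (?h z) * deriv ?h z * of_real (inverse (?s z))
        + of_real 2 * (cnj (\<omega> z) * deriv \<omega> z) * of_real (inverse (1 + ?t z))"
      unfolding a by (simp add: divide_inverse)
    then have "?A * v = of_real (inverse (?s z)) * (cnj (?h z) * deriv ?h z * v)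
        + of_real (2 * inverse (1 + ?t z)) * (cnj (\<omega> z) * deriv \<omega> z * v)"
      by (simp add: algebra_simps)
    then have "Re (?A * v) = inverse (?s z) * Re (cnj (?h z) * deriv ?h z * v)
        + 2 * inverse (1 + ?t z) * Re (cnj (\<omega> z) * deriv \<omega> z * v)"
      by (simp only: plus_complex.sel Re_complex_of_real Im_complex_of_real times_complex.sel
          mult_zero_left diff_zero)
    then show "2 * Re (cnj (?h z) * deriv ?h z * v) * inverse (?s z) * (1/2)
        + 2 * Re (cnj (\<omega> z) * deriv \<omega> z * v) * inverse (1 + ?t z) = Re (?A * v)"
      by (simp only: aux)
  qed
  then have "((\<lambda>w. ln (cmod (?h w) + cmod (deriv g w))) has_derivative (\<lambda>v. Re (?A * v))) (at z)"
    by (rule has_derivative_transform_within_open[OF _ open_ball z]) (simp add: lam)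
  then have "((\<lambda>w. complex_of_real (ln (cmod (?h w) + cmod (deriv g w)))) has_derivative
      (\<lambda>v. of_real (Re (?A * v)))) (at z)"
    by (rule has_derivative_of_real)
  then have "frechet_derivative (\<lambda>w. complex_of_real (ln (cmod (?h w) + cmod (deriv g w)))) (at z)
      = (\<lambda>v. of_real (Re (?A * v)))"
    by (rule frechet_derivative_at[symmetric])
  then have "harmonic_pre_schwarzian h g z = of_real (Re (?A * 1)) - \<i> * of_real (Re (?A * \<i>))"
    by (simp add: harmonic_pre_schwarzian_def wirtinger_dz_def)
  also have "\<dots> = ?A"
  proof -
    have "of_real (Re (A * 1)) - \<i> * of_real (Re (A * \<i>)) = A" for A :: complex
      by (simp add: complex_eq_iff)
    then show ?thesis .
  qed
  finally show ?thesis .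
qed

end

theory Submission
  imports Defs
begin

text \<open>With dilatation \<open>\<omega>\<^sup>2\<close>, the two pre-Schwarzian derivatives differ pointwise by
  \<open>2 cnj \<omega> \<omega>' / (1 + |\<omega>|\<^sup>2)\<close>. The Schwarz--Pick inequality
  \<open>(1 - |z|\<^sup>2) |\<omega>'| \<le> 1 - |\<omega>|\<^sup>2\<close> (lemma \<open>Schwarz_Pick_deriv\<close>) bounds its weighted modulus by
  \<open>2t(1 - t\<^sup>2)/(1 + t\<^sup>2)\<close> with \<open>t = |\<omega>(z)|\<close>, a function of one real variable whose maximum on
  \<open>t \<ge> 0\<close> is attained at \<open>r0\<close>, the positive root of \<open>t\<^sup>4 + 4t\<^sup>2 = 1\<close>
  (lemma \<open>ratio_le_ratio_r0\<close>). A uniformly bounded weighted difference changes the supremum norm by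
  at most that bound and preserves finiteness (lemma \<open>hyperbolic_norm_le_add\<close>).

  Every inequality in this chain is an equality for \<open>h(z) = z\<close>, \<open>\<omega>(z) = z\<close> at \<open>z = r0\<close>: then
  \<open>P\<^sub>h\<close> vanishes identically, and \<open>f(z) = z + cnj (z\<^sup>3/3)\<close> has norm exactly the claimed constant.\<close>

text \<open>Moving \<open>a\<close> and \<open>f a\<close> to the origin by disk automorphisms reduces the claim to the Schwarz
  lemma; the factors \<open>1 - |a|\<^sup>2\<close> and \<open>1 / (1 - |f a|\<^sup>2)\<close> are the derivatives of the two
  automorphisms.\<close>

lemma Schwarz_Pick_deriv:
  assumes f: "f holomorphic_on unit_disk" and fd: "f ` unit_disk \<subseteq> unit_disk"
    and a: "a \<in> unit_disk"
  shows "(1 - (cmod a)\<^sup>2) * cmod (deriv f a) \<le> 1 - (cmod (f a))\<^sup>2"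
proof -
  define b where "b = f a"
  define F where "F = (\<lambda>z. Moebius_function 0 b (f (Moebius_function 0 (-a) z)))"
  have a1: "cmod a < 1" using a by simp
  have b1: "cmod b < 1" using fd a by (simp add: b_def image_subset_iff)
  have M: "Moebius_function 0 (-a) z \<in> unit_disk" if "cmod z < 1" for z
    using Moebius_function_norm_lt_1[of "-a" z 0] a1 that by simp
  have holM: "Moebius_function 0 (-a) holomorphic_on unit_disk"
    "Moebius_function 0 b holomorphic_on unit_disk"
    using Moebius_function_holomorphic a1 b1 by simp_all
  have "(f \<circ> Moebius_function 0 (-a)) holomorphic_on unit_disk"
    by (rule holomorphic_on_compose_gen[OF holM(1) f]) (use M in auto)
  then have "(Moebius_function 0 b \<circ> (f \<circ> Moebius_function 0 (-a))) holomorphic_on unit_disk"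
    by (rule holomorphic_on_compose_gen[OF _ holM(2)]) (use M fd in auto)
  then have holF: "F holomorphic_on unit_disk"
    by (simp add: F_def o_def)
  have F1: "cmod (F z) < 1" if "cmod z < 1" for z
    using M[OF that] fd b1 unfolding F_def image_subset_iff
    by (intro Moebius_function_norm_lt_1) auto
  have M0: "Moebius_function 0 (-a) 0 = a"
    by (simp add: Moebius_function_of_zero)
  have F0: "F 0 = 0"
    by (simp add: F_def M0 b_def Moebius_function_eq_zero)
  have nzb: "1 - cnj b * b \<noteq> 0"
    using b1 by (metis complex_norm_square mult.commute of_real_1 of_real_eq_iff
        abs_norm_cancel abs_square_eq_1 less_irrefl right_minus_eq)
  have D1: "(Moebius_function 0 (-a) has_field_derivative (1 - cnj a * a)) (at 0)"
    unfolding Moebius_function_def by (auto intro!: derivative_eq_intros)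
  have "(Moebius_function 0 b has_field_derivative
      ((1 - cnj b * b) / ((1 - cnj b * b) * (1 - cnj b * b)))) (at b)"
    unfolding Moebius_function_def using nzb by (auto intro!: derivative_eq_intros)
  then have D3: "(Moebius_function 0 b has_field_derivative (1 / (1 - cnj b * b))) (at b)"
    using nzb by simp
  have D2: "(f has_field_derivative deriv f a) (at a)"
    using f a by (auto intro: holomorphic_derivI)
  have D12: "((\<lambda>z. f (Moebius_function 0 (-a) z)) has_field_derivative
      deriv f a * (1 - cnj a * a)) (at 0)"
    using DERIV_chain2[of f "deriv f a" "Moebius_function 0 (-a)" 0] D1 D2 M0 by simp
  have "(F has_field_derivative 1 / (1 - cnj b * b) * (deriv f a * (1 - cnj a * a))) (at 0)"
    unfolding F_def
    using DERIV_chain2[OF _ D12, of "Moebius_function 0 b" "1 / (1 - cnj b * b)"] D3 M0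
    by (simp add: b_def)
  then have "deriv F 0 = 1 / (1 - cnj b * b) * (deriv f a * (1 - cnj a * a))"
    by (rule DERIV_imp_deriv)
  moreover have "cmod (deriv F 0) \<le> 1"
    using Schwarz_Lemma(2)[OF holF F0 F1, of 0] by simp
  moreover have "cmod (1 - cnj w * w) = 1 - (cmod w)\<^sup>2" if "cmod w < 1" for w
  proof -
    have "1 - cnj w * w = of_real (1 - (cmod w)\<^sup>2)"
      by (simp add: complex_norm_square mult.commute del: of_real_power)
    moreover have "(cmod w)\<^sup>2 \<le> 1"
      using that by (simp add: power_le_one)
    ultimately show ?thesis
      by (simp only: norm_of_real abs_of_nonneg diff_ge_0_iff_ge)
  qed
  ultimately have "cmod (deriv f a) * (1 - (cmod a)\<^sup>2) / (1 - (cmod b)\<^sup>2) \<le> 1"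
    using a1 b1 by (simp add: norm_mult norm_divide)
  moreover have "1 - (cmod b)\<^sup>2 > 0"
    using b1 by (simp add: abs_square_less_1)
  ultimately show ?thesis
    by (simp add: b_def field_simps)
qed

lemma r0_pos: "r0 > 0" and r0_sq: "r0\<^sup>2 = sqrt 5 - 2" and r0_less_1: "r0 < 1"
proof -
  have "sqrt 5 > 2" "sqrt 5 < 3"
    by (simp_all add: real_less_rsqrt real_less_lsqrt)
  then show "r0 > 0" "r0\<^sup>2 = sqrt 5 - 2" "r0 < 1"
    by (simp_all add: r0_def real_less_lsqrt)
qed

lemma r0_quartic: "r0 ^ 4 + 4 * r0\<^sup>2 = 1"
proof -
  have "(r0\<^sup>2)\<^sup>2 + 4 * r0\<^sup>2 = 1"
    unfolding r0_sq by (simp add: power2_eq_square algebra_simps)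
  then show ?thesis by simp
qed

text \<open>Since \<open>r0\<close> is a critical point, the cleared difference of the two sides has a double root at
  \<open>t = r0\<close>; the remaining linear factor has nonnegative coefficients.\<close>

lemma ratio_le_ratio_r0:
  fixes t :: real
  assumes t: "t \<ge> 0"
  shows "2 * t * (1 - t\<^sup>2) / (1 + t\<^sup>2) \<le> 2 * r0 * (1 - r0\<^sup>2) / (1 + r0\<^sup>2)"
proof -
  have r1: "r0\<^sup>2 \<le> 1"
    using r0_pos r0_less_1 by (simp add: power_le_one)
  \<comment> \<open>The factorisation holds only modulo the quartic relation satisfied by \<open>r0\<close>.\<close>
  have "r0 * (r0 * (1 - r0\<^sup>2) * (1 + t\<^sup>2) - t * (1 - t\<^sup>2) * (1 + r0\<^sup>2))
      - (t - r0)\<^sup>2 * ((1 + r0\<^sup>2) * r0 * t + (1 - r0\<^sup>2))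
    = (r0 ^ 4 + 4 * r0\<^sup>2 - 1) * (t\<^sup>2 - r0 * t)"
    by (simp add: algebra_simps power2_eq_square power4_eq_xxxx)
  then have "r0 * (r0 * (1 - r0\<^sup>2) * (1 + t\<^sup>2) - t * (1 - t\<^sup>2) * (1 + r0\<^sup>2))
    = (t - r0)\<^sup>2 * ((1 + r0\<^sup>2) * r0 * t + (1 - r0\<^sup>2))"
    by (simp add: r0_quartic)
  also have "\<dots> \<ge> 0"
    using t r1 r0_pos by (intro mult_nonneg_nonneg add_nonneg_nonneg) auto
  finally have "t * (1 - t\<^sup>2) * (1 + r0\<^sup>2) \<le> r0 * (1 - r0\<^sup>2) * (1 + t\<^sup>2)"
    using r0_pos by (simp add: zero_le_mult_iff)
  moreover have "1 + t\<^sup>2 > 0" "1 + r0\<^sup>2 > 0"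
    by (simp_all add: add_pos_nonneg)
  ultimately have "t * (1 - t\<^sup>2) / (1 + t\<^sup>2) \<le> r0 * (1 - r0\<^sup>2) / (1 + r0\<^sup>2)"
    by (simp add: divide_le_eq pos_le_divide_eq mult.commute mult.left_commute)
  then show ?thesis
    by simp
qed

text \<open>The square of the constant is \<open>10 \<surd>5 - 22\<close>, so the decimal bounds reduce to bounds on
  \<open>\<surd>5\<close>.\<close>

lemma ratio_r0_bounds:
  "0.6005 \<le> 2 * r0 * (1 - r0\<^sup>2) / (1 + r0\<^sup>2)"
  "2 * r0 * (1 - r0\<^sup>2) / (1 + r0\<^sup>2) < 0.6006"
proof -
  let ?c = "2 * r0 * (1 - r0\<^sup>2) / (1 + r0\<^sup>2)"
  have s: "2.236067 < sqrt 5" "sqrt 5 < 2.236071"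
    by (rule real_less_rsqrt real_less_lsqrt; simp add: power2_eq_square)+
  have c0: "?c \<ge> 0"
    using ratio_le_ratio_r0[of 0] by simp
  have "(1 - r0\<^sup>2) / (1 + r0\<^sup>2) = (sqrt 5 - 1) / 2"
    unfolding r0_sq using s by (simp add: field_simps)
  then have "?c = r0 * (sqrt 5 - 1)"
    by (metis (no_types, opaque_lifting) mult.assoc mult.left_commute nonzero_mult_div_cancel_left
        times_divide_eq_right zero_neq_numeral)
  then have "?c\<^sup>2 = (sqrt 5 - 2) * (sqrt 5 - 1)\<^sup>2"
    by (simp add: power_mult_distrib r0_sq)
  also have "\<dots> = 10 * sqrt 5 - 22"
    by (simp add: power2_eq_square algebra_simps)
  finally have c2: "?c\<^sup>2 = 10 * sqrt 5 - 22" .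
  have "(0.6005::real)\<^sup>2 \<le> ?c\<^sup>2"
    unfolding c2 using s by (simp add: power2_eq_square)
  then show "0.6005 \<le> ?c"
    using c0 by (rule power2_le_imp_le)
  have "?c\<^sup>2 < (0.6006::real)\<^sup>2"
    unfolding c2 using s by (simp add: power2_eq_square)
  then show "?c < 0.6006"
    by (rule power2_less_imp_less) simp
qed

lemma hyperbolic_norm_le_add:
  assumes "\<And>z. z \<in> unit_disk \<Longrightarrow> (1 - (cmod z)\<^sup>2) * cmod (P z - Q z) \<le> c"
  shows "hyperbolic_norm P \<le> hyperbolic_norm Q + ennreal c"
  unfolding hyperbolic_norm_def[of P]
proof (rule SUP_least)
  fix z :: complex assume z: "z \<in> unit_disk"
  have w: "1 - (cmod z)\<^sup>2 \<ge> 0"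
    using z by (simp add: power_le_one)
  have c: "c \<ge> 0"
    using assms[OF z] w by (meson mult_nonneg_nonneg norm_ge_zero order_trans)
  have "cmod (P z) \<le> cmod (Q z) + cmod (P z - Q z)"
    by (metis add.commute diff_add_cancel norm_triangle_ineq)
  then have "(1 - (cmod z)\<^sup>2) * cmod (P z) \<le> (1 - (cmod z)\<^sup>2) * (cmod (Q z) + cmod (P z - Q z))"
    using w by (rule mult_left_mono)
  also have "\<dots> \<le> (1 - (cmod z)\<^sup>2) * cmod (Q z) + c"
    using assms[OF z] by (simp add: distrib_left)
  finally have "ennreal ((1 - (cmod z)\<^sup>2) * cmod (P z))
      \<le> ennreal ((1 - (cmod z)\<^sup>2) * cmod (Q z)) + ennreal c"
    using w c by (simp add: ennreal_leI flip: ennreal_plus)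
  also have "\<dots> \<le> hyperbolic_norm Q + ennreal c"
    unfolding hyperbolic_norm_def by (intro add_right_mono SUP_upper z)
  finally show "ennreal ((1 - (cmod z)\<^sup>2) * cmod (P z)) \<le> hyperbolic_norm Q + ennreal c" .
qed

lemma pre_schwarzian_difference_le:
  assumes "harmonic_class f h g" "sense_preserving h g"
    and om: "\<omega> holomorphic_on unit_disk" and omd: "\<omega> ` unit_disk \<subseteq> unit_disk"
    and "\<forall>z\<in>unit_disk. dilatation h g z = (\<omega> z)\<^sup>2"
    and z: "z \<in> unit_disk"
  shows "(1 - (cmod z)\<^sup>2) * cmod (harmonic_pre_schwarzian h g z - pre_schwarzian h z)
    \<le> 2 * r0 * (1 - r0\<^sup>2) / (1 + r0\<^sup>2)"
proof -
  define t where "t = cmod (\<omega> z)"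
  have t: "t \<ge> 0" and pos: "1 + t\<^sup>2 > 0"
    by (simp_all add: t_def add_pos_nonneg)
  have "harmonic_pre_schwarzian h g z - pre_schwarzian h z
      = 2 * cnj (\<omega> z) * deriv \<omega> z / of_real (1 + t\<^sup>2)"
    using harmonic_pre_schwarzian_eq[OF assms(1,2) om assms(5) z]
    by (simp add: pre_schwarzian_def t_def)
  then have "cmod (harmonic_pre_schwarzian h g z - pre_schwarzian h z)
      = 2 * t * cmod (deriv \<omega> z) / (1 + t\<^sup>2)"
    using pos by (simp only: norm_divide norm_mult norm_of_real) (simp add: t_def)
  then have "(1 - (cmod z)\<^sup>2) * cmod (harmonic_pre_schwarzian h g z - pre_schwarzian h z)
      = 2 * t * ((1 - (cmod z)\<^sup>2) * cmod (deriv \<omega> z)) / (1 + t\<^sup>2)"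
    by simp
  also have "\<dots> \<le> 2 * t * (1 - t\<^sup>2) / (1 + t\<^sup>2)"
    using Schwarz_Pick_deriv[OF om omd z] t pos
    by (intro divide_right_mono mult_left_mono) (auto simp: t_def)
  also have "\<dots> \<le> 2 * r0 * (1 - r0\<^sup>2) / (1 + r0\<^sup>2)"
    by (rule ratio_le_ratio_r0[OF t])
  finally show ?thesis .
qed

lemma hyperbolic_norm_pre_schwarzian_le:
  assumes "harmonic_class f h g" "sense_preserving h g"
    and "\<omega> holomorphic_on unit_disk" "\<omega> ` unit_disk \<subseteq> unit_disk"
    and "\<forall>z\<in>unit_disk. dilatation h g z = (\<omega> z)\<^sup>2"
  shows "hyperbolic_norm (harmonic_pre_schwarzian h g)
      \<le> hyperbolic_norm (pre_schwarzian h) + ennreal (2 * r0 * (1 - r0\<^sup>2) / (1 + r0\<^sup>2))"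
    and "hyperbolic_norm (pre_schwarzian h)
      \<le> hyperbolic_norm (harmonic_pre_schwarzian h g) + ennreal (2 * r0 * (1 - r0\<^sup>2) / (1 + r0\<^sup>2))"
  using pre_schwarzian_difference_le[OF assms]
  by (auto intro!: hyperbolic_norm_le_add simp: norm_minus_commute)

lemma ennreal_close_imp:
  assumes "x \<le> y + ennreal c" "y \<le> x + ennreal c" "c \<ge> 0"
  shows "x = \<infinity> \<and> y = \<infinity> \<or> x < \<infinity> \<and> y < \<infinity>"
    and "x < \<infinity> \<Longrightarrow> \<bar>enn2real x - enn2real y\<bar> \<le> c"
  using assms
  by (cases x; cases y; auto simp: top_unique abs_le_iff simp flip: ennreal_plus)+

text \<open>Identity analytic part and identity \<open>\<omega>\<close>: equality in Schwarz--Pick everywhere, and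
  \<open>P\<^sub>h = 0\<close>, so nothing interferes with the correction term.\<close>

lemma extremal_mapping:
  defines "h \<equiv> (\<lambda>z::complex. z)" and "g \<equiv> (\<lambda>z::complex. z ^ 3 / 3)"
  shows "harmonic_class (\<lambda>z. h z + cnj (g z)) h g" "sense_preserving h g"
    "\<forall>z\<in>unit_disk. dilatation h g z = z\<^sup>2"
    "hyperbolic_norm (pre_schwarzian h) = 0"
    "ennreal (2 * r0 * (1 - r0\<^sup>2) / (1 + r0\<^sup>2)) \<le> hyperbolic_norm (harmonic_pre_schwarzian h g)"
proof -
  have dh: "deriv h = (\<lambda>z. 1)"
    by (auto simp: h_def)
  have dg: "deriv g = (\<lambda>z. z\<^sup>2)"
    unfolding g_def by (rule ext, rule DERIV_imp_deriv) (auto intro!: derivative_eq_intros)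
  show hc: "harmonic_class (\<lambda>z. h z + cnj (g z)) h g"
    unfolding harmonic_class_def dh by (auto simp: h_def g_def intro!: holomorphic_intros)
  show sp: "sense_preserving h g"
    by (auto simp: sense_preserving_def jacobian_def dh dg norm_power power_less_one_iff
        simp flip: power_mult)
  show dil: "\<forall>z\<in>unit_disk. dilatation h g z = z\<^sup>2"
    by (simp add: dilatation_def dh dg)
  show "hyperbolic_norm (pre_schwarzian h) = 0"
    by (simp add: hyperbolic_norm_def pre_schwarzian_def dh)
  have r: "complex_of_real r0 \<in> unit_disk"
    using r0_pos r0_less_1 by simp
  have "harmonic_pre_schwarzian h g (of_real r0) = of_real (2 * r0 / (1 + r0\<^sup>2))"
    using harmonic_pre_schwarzian_eq[OF hc sp holomorphic_on_ident dil r] r0_pos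
    by (simp add: dh)
  then have "cmod (harmonic_pre_schwarzian h g (of_real r0)) = 2 * r0 / (1 + r0\<^sup>2)"
    using r0_pos by (simp only: norm_of_real) (simp add: add_pos_nonneg)
  then have "ennreal (2 * r0 * (1 - r0\<^sup>2) / (1 + r0\<^sup>2))
      = ennreal ((1 - (cmod (of_real r0))\<^sup>2) * cmod (harmonic_pre_schwarzian h g (of_real r0)))"
    by (simp add: mult.commute)
  also have "\<dots> \<le> hyperbolic_norm (harmonic_pre_schwarzian h g)"
    unfolding hyperbolic_norm_def by (rule SUP_upper[OF r])
  finally show "ennreal (2 * r0 * (1 - r0\<^sup>2) / (1 + r0\<^sup>2))
      \<le> hyperbolic_norm (harmonic_pre_schwarzian h g)" .
qed

theorem theorem3p1:
  shows "(\<forall>f h g \<omega>.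
      harmonic_class f h g \<and> sense_preserving h g \<and>
      \<omega> holomorphic_on unit_disk \<and> \<omega> ` unit_disk \<subseteq> unit_disk \<and>
      (\<forall>z\<in>unit_disk. dilatation h g z = (\<omega> z)\<^sup>2) \<longrightarrow>
        (hyperbolic_norm (harmonic_pre_schwarzian h g) = \<infinity> \<and>
           hyperbolic_norm (pre_schwarzian h) = \<infinity> \<or>
         hyperbolic_norm (harmonic_pre_schwarzian h g) < \<infinity> \<and>
           hyperbolic_norm (pre_schwarzian h) < \<infinity>) \<and>
        (hyperbolic_norm (harmonic_pre_schwarzian h g) < \<infinity> \<longrightarrow>
          \<bar>enn2real (hyperbolic_norm (harmonic_pre_schwarzian h g))
             - enn2real (hyperbolic_norm (pre_schwarzian h))\<bar>
          \<le> 2 * r0 * (1 - r0\<^sup>2) / (1 + r0\<^sup>2)))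
    \<and> (0.6005 \<le> 2 * r0 * (1 - r0\<^sup>2) / (1 + r0\<^sup>2) \<and>
       2 * r0 * (1 - r0\<^sup>2) / (1 + r0\<^sup>2) < 0.6006)
    \<and> (\<forall>C::real.
        (\<forall>f h g \<omega>.
          harmonic_class f h g \<and> sense_preserving h g \<and>
          \<omega> holomorphic_on unit_disk \<and> \<omega> ` unit_disk \<subseteq> unit_disk \<and>
          (\<forall>z\<in>unit_disk. dilatation h g z = (\<omega> z)\<^sup>2) \<and>
          hyperbolic_norm (harmonic_pre_schwarzian h g) < \<infinity> \<longrightarrow>
            \<bar>enn2real (hyperbolic_norm (harmonic_pre_schwarzian h g))
               - enn2real (hyperbolic_norm (pre_schwarzian h))\<bar> \<le> C)
        \<longrightarrow> 2 * r0 * (1 - r0\<^sup>2) / (1 + r0\<^sup>2) \<le> C)"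
proof (intro conjI allI impI ratio_r0_bounds, goal_cases)
  case (1 f h g \<omega>)
  then show ?case
    using ennreal_close_imp(1)[OF hyperbolic_norm_pre_schwarzian_le[of f h g \<omega>]] ratio_r0_bounds
    by auto
next
  case (2 f h g \<omega>)
  then show ?case
    using ennreal_close_imp(2)[OF hyperbolic_norm_pre_schwarzian_le[of f h g \<omega>]] ratio_r0_bounds
    by auto
next
  case (3 C)
  let ?h = "\<lambda>z::complex. z" and ?g = "\<lambda>z::complex. z ^ 3 / 3"
  let ?N = "hyperbolic_norm (harmonic_pre_schwarzian ?h ?g)"
  let ?c = "2 * r0 * (1 - r0\<^sup>2) / (1 + r0\<^sup>2)"
  have fin: "?N < \<infinity>"
  proof -
    have "?N \<le> 0 + ennreal ?c"
      using hyperbolic_norm_pre_schwarzian_le(1)[OF extremal_mapping(1,2) holomorphic_on_ident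
          _ extremal_mapping(3)] extremal_mapping(4) by simp
    then show ?thesis
      by (simp add: order_le_less_trans)
  qed
  have "?c \<le> enn2real ?N"
    using enn2real_mono[OF extremal_mapping(5)] fin ratio_r0_bounds(1) by simp
  also have "\<dots> = \<bar>enn2real ?N - enn2real (hyperbolic_norm (pre_schwarzian ?h))\<bar>"
    using extremal_mapping(4) by simp
  also have "\<dots> \<le> C"
    by (rule 3[rule_format, of "\<lambda>z. z + cnj (z ^ 3 / 3)" ?h ?g "\<lambda>z. z"])
      (use extremal_mapping fin in auto)
  finally show ?case .
qed

end
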